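(* Let $\{A(t)\}_{t\ge0}$ be a discrete time chain of $N\times N$ row-stochastic matrices and $\mathcal V=\{1,\dots,N\}$. The unique jet decomposition of $\mathcal V$ with respect to the chain $\{A(t)\}$ in the Sonin Decomposition-Separation Theorem consists of the jet $J^0$ and $\mathbf{rank}(A)$ other jets.
   Context: Time indices are non-negative integers; write $A(t)=(a_{ij}(t))$. The state transition matrix is $\Phi(t,\tau)=A(t-1)\cdots A(\tau)$ for $t>\tau\ge0$, and $\Phi(t,t)=I$. The associated opinion dynamics are $x(t+1)=A(t)x(t)$, $t\ge t_0$, with $x(t)\in\mathbb R^N$ and initial time $t_0\ge0$. Rank: for $\tau\ge0$, $\mathbf{null}_\tau(A)=\{v\in\mathbb R^N:\lim_{t\to\infty}\Phi(t,\tau)v=\mathbf 0_N\}$, where $\mathbf 0_N$ is the zero vector. The dimension of this vector space is non-increasing in $\tau$, hence eventually constant. $\mathbf{nullity}(A)=\lim_{\tau\to\infty}\dim(\mathbf{null}_\tau(A))$ and $\mathbf{rank}(A)=N-\mathbf{nullity}(A)$. Jets: a jet $J$ in $\mathcal V$ is a sequence $\{J(t)\}_{t\ge0}$ of subsets of $\mathcal V$; its complement $\mathcal V\setminus J$ is the jet $\{\mathcal V\setminus J(t)\}$. A tuple of jets is a jet-partition of $\mathcal V$ if at every $t\ge0$ the corresponding sets form a partition of $\mathcal V$. Absolute probability sequence: the chain $\{A(t)\}$ admits (Kolmogorov) a sequence $\{\pi(t)\}_{t\ge0}$ of stochastic vectors (non-negative entries summing to 1) in $\mathbb R^N$ with $\pi'(t+1)A(t)=\pi'(t)$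 for all $t\ge0$ ($'$ is transpose). Total flow: with $r_{ij}(t)=\pi_j(t+1)a_{ji}(t)$, for jets $J^s,J^k$ in $\mathcal V$, $$V(J^s,J^k)=\sum_{t=0}^\infty\Big[\sum_{i\in J^k(t)}\sum_{j\in J^s(t+1)}r_{ij}(t)+\sum_{i\in J^s(t)}\sum_{j\in J^k(t+1)}r_{ij}(t)\Big].$$ Sonin Decomposition-Separation Theorem (a known result), as stated in the source: there exist an integer $c$, $1\le c\le N$, and a decomposition of $\mathcal V$ into a jet-partition $(J^0,J^1,\dots,J^c)$, $J^k=\{J^k(t)\}$, such that, irrespective of the particular time or values at which the $x_i$'s are initialized: (i) for every $k$, $1\le k\le c$, there exist real constants $\pi^*_k$ and $x^*_k$ such that $\lim_{t\to\infty}\sum_{i\in J^k(t)}\pi_i(t)=\pi^*_k$ and $\lim_{t\to\infty}x_{i_t}(t)=x^*_k$ for every sequence $\{i_t\}$ with $i_t\in J^k(t)$; furthermore, $\lim_{t\to\infty}\sum_{i\in J^0(t)}\pi_i(t)=0$; (ii) for every distinct $k,s$, $0\le k,s\le c$, $V(J^k,J^s)<\infty$; (iii) this decomposition is unique up to jets $\{J(t)\}$ such that for any $\{\pi(t)\}$ we have $\lim_{t\to\infty}\sum_{i\in J(t)}\pi_i(t)=0$ and $V(J,\mathcal V\setminus J)<\infty$. *)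

theory Defs
  imports "HOL-Analysis.Analysis" "HOL-Library.Disjoint_Sets"
begin

text \<open>Vertices are the elements of the finite index type \<open>'n\<close>, so \<open>N = CARD('n)\<close>.\<close>

definition stochastic_vector :: "real ^ 'n \<Rightarrow> bool" where
  "stochastic_vector p \<longleftrightarrow> (\<forall>i. 0 \<le> p $ i) \<and> (\<Sum>i\<in>UNIV. p $ i) = 1"

definition row_stochastic :: "real ^ 'n ^ 'n \<Rightarrow> bool" where
  "row_stochastic M \<longleftrightarrow> (\<forall>i. stochastic_vector (M $ i))"

primrec forward_product :: "(nat \<Rightarrow> real ^ 'n ^ 'n) \<Rightarrow> nat \<Rightarrow> nat \<Rightarrow> real ^ 'n ^ 'n" where
  "forward_product A \<tau> 0 = mat 1"
| "forward_product A \<tau> (Suc m) = A (\<tau> + m) ** forward_product A \<tau> m"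

text \<open>For \<open>t \<ge> \<tau>\<close> this is \<open>A (t - 1) ** \<dots> ** A \<tau>\<close>; the value for \<open>t < \<tau>\<close> is irrelevant.\<close>

definition state_transition :: "(nat \<Rightarrow> real ^ 'n ^ 'n) \<Rightarrow> nat \<Rightarrow> nat \<Rightarrow> real ^ 'n ^ 'n" where
  "state_transition A t \<tau> = forward_product A \<tau> (t - \<tau>)"

definition opinion_trajectory ::
    "(nat \<Rightarrow> real ^ 'n ^ 'n) \<Rightarrow> nat \<Rightarrow> (nat \<Rightarrow> real ^ 'n) \<Rightarrow> bool" where
  "opinion_trajectory A t0 x \<longleftrightarrow> (\<forall>t\<ge>t0. x (t + 1) = A t *v x t)"

definition chain_null :: "(nat \<Rightarrow> real ^ 'n ^ 'n) \<Rightarrow> nat \<Rightarrow> (real ^ 'n) set" where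
  "chain_null A \<tau> = {v. (\<lambda>t. state_transition A t \<tau> *v v) \<longlonglongrightarrow> 0}"

definition chain_nullity :: "(nat \<Rightarrow> real ^ 'n ^ 'n) \<Rightarrow> nat" where
  "chain_nullity A = lim (\<lambda>\<tau>. dim (chain_null A \<tau>))"

definition chain_rank :: "(nat \<Rightarrow> real ^ 'n ^ 'n) \<Rightarrow> nat" where
  "chain_rank A = CARD('n) - chain_nullity A"

definition absolute_probability ::
    "(nat \<Rightarrow> real ^ 'n ^ 'n) \<Rightarrow> (nat \<Rightarrow> real ^ 'n) \<Rightarrow> bool" where
  "absolute_probability A p \<longleftrightarrow>
     (\<forall>t. stochastic_vector (p t)) \<and> (\<forall>t. p (t + 1) v* A t = p t)"

type_synonym 'n jet = "nat \<Rightarrow> 'n set"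

definition jet_compl :: "'n jet \<Rightarrow> 'n jet" where
  "jet_compl J = (\<lambda>t. UNIV - J t)"

text \<open>Blocks may be empty at some times: \<open>J 0\<close> has to be empty, for instance, if all \<open>A t\<close> are
  the identity.\<close>

definition jet_partition :: "nat \<Rightarrow> (nat \<Rightarrow> 'n jet) \<Rightarrow> bool" where
  "jet_partition c J \<longleftrightarrow>
     (\<forall>t. (\<Union>k\<le>c. J k t) = UNIV \<and> disjoint_family_on (\<lambda>k. J k t) {..c})"

definition flow :: "(nat \<Rightarrow> real ^ 'n ^ 'n) \<Rightarrow> (nat \<Rightarrow> real ^ 'n) \<Rightarrow> 'n \<Rightarrow> 'n \<Rightarrow> nat \<Rightarrow> real" where
  "flow A p i j t = p (t + 1) $ j * A t $ j $ i"

definition total_flow ::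
    "(nat \<Rightarrow> real ^ 'n ^ 'n) \<Rightarrow> (nat \<Rightarrow> real ^ 'n) \<Rightarrow> 'n jet \<Rightarrow> 'n jet \<Rightarrow> ennreal" where
  "total_flow A p Js Jk =
     (\<Sum>t. ennreal ((\<Sum>i\<in>Jk t. \<Sum>j\<in>Js (t + 1). flow A p i j t)
                 + (\<Sum>i\<in>Js t. \<Sum>j\<in>Jk (t + 1). flow A p i j t)))"

text \<open>The jets up to which the decomposition below is unique.\<close>

definition negligible_jet :: "(nat \<Rightarrow> real ^ 'n ^ 'n) \<Rightarrow> 'n jet \<Rightarrow> bool" where
  "negligible_jet A J \<longleftrightarrow>
     (\<forall>p. absolute_probability A p \<longrightarrow>
        (\<lambda>t. \<Sum>i\<in>J t. p t $ i) \<longlonglongrightarrow> 0 \<and> total_flow A p J (jet_compl J) < \<infinity>)"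

text \<open>The decomposition in Sonin's theorem belongs to the chain alone, so the conditions are imposed
  for every absolute probability sequence \<open>p\<close>. For a single degenerate \<open>p\<close> the decomposition
  would not be determined by them, even up to negligible jets: for the identity chain on two
  vertices and \<open>p = (1, 0)\<close>, vertex 2 could form a jet \<open>J 2\<close> or be put into \<open>J 0\<close>.
  The limits of the opinions may depend on the trajectory.\<close>

definition sonin_decomposition ::
    "(nat \<Rightarrow> real ^ 'n ^ 'n) \<Rightarrow> nat \<Rightarrow> (nat \<Rightarrow> 'n jet) \<Rightarrow> bool" where
  "sonin_decomposition A c J \<longleftrightarrow>
     1 \<le> c \<and> c \<le> CARD('n) \<and> jet_partition c J \<and>
     (\<forall>k\<in>{1..c}.
        (\<forall>p. absolute_probability A p \<longrightarrow>
           (\<exists>pstar. (\<lambda>t. \<Sum>i\<in>J k t. p t $ i) \<longlonglongrightarrow> pstar)) \<and>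
        (\<forall>t0 x. opinion_trajectory A t0 x \<longrightarrow>
           (\<exists>xstar. \<forall>i. (\<forall>t\<ge>t0. i t \<in> J k t) \<longrightarrow> (\<lambda>t. x t $ i t) \<longlonglongrightarrow> xstar))) \<and>
     (\<forall>p. absolute_probability A p \<longrightarrow> (\<lambda>t. \<Sum>i\<in>J 0 t. p t $ i) \<longlonglongrightarrow> 0) \<and>
     (\<forall>p. absolute_probability A p \<longrightarrow>
        (\<forall>k\<le>c. \<forall>s\<le>c. k \<noteq> s \<longrightarrow> total_flow A p (J k) (J s) < \<infinity>))"

end

theory Submission imports Defs begin

text \<open>Let \<open>K\<close> be the set of non-negligible jets and, for \<open>k \<in> K\<close>, let \<open>L k v\<close> be the limit along
  \<open>J k\<close> of the trajectory started at \<open>v\<close> at time \<open>\<tau>\<close>; this is a linear functional of \<open>v\<close>. The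
  null space at \<open>\<tau>\<close> is the common kernel of the functionals \<open>L k\<close>: by Kolmogorov's compactness
  argument \<open>v\<close> lies in it as soon as \<open>p \<tau> \<bullet> v = 0\<close> for all absolute probability sequences \<open>p\<close>, and
  \<open>p \<tau> \<bullet> v = p t \<bullet> x t\<close> splits into one sum per jet, each tending to \<open>0\<close> if all \<open>L k v\<close> vanish.
  For large \<open>\<tau>\<close> the functionals are linearly independent: as the total flow between jets is finite,
  hardly any mass is exchanged after time \<open>\<tau>\<close>, so on the indicator vectors of the sets \<open>J k \<tau>\<close> their
  matrix is close to the identity. Hence the null space has codimension \<open>card K\<close>.\<close>

section \<open>Codimension of a common kernel\<close>

text \<open>The matrix \<open>L j (v k)\<close> is the identity up to an error whose rows have
  absolute sum below 1, hence invertible. So the span \<open>T\<close> of the \<open>v k\<close> has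
  dimension \<open>card K\<close> and is a complement of the common kernel \<open>Z\<close>.\<close>

lemma dim_common_kernel_near_dual:
  fixes L :: "'k \<Rightarrow> 'a::euclidean_space \<Rightarrow> real" and v :: "'k \<Rightarrow> 'a"
  assumes fin: "finite K" and lin: "\<And>k. k \<in> K \<Longrightarrow> linear (L k)"
    and near: "\<And>j k. j \<in> K \<Longrightarrow> k \<in> K \<Longrightarrow> \<bar>L j (v k) - (if j = k then 1 else 0)\<bar> \<le> \<delta>"
    and small: "real (card K) * \<delta> < 1"
  shows "dim {x. \<forall>k\<in>K. L k x = 0} + card K = DIM('a)"
proof -
  define Z where "Z = {x. \<forall>k\<in>K. L k x = 0}"
  define T where "T = span (v ` K)"
  \<comment> \<open>\<open>L j\<close> is applied at an index \<open>j\<close> where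
    \<open>\<bar>d j\<bar>\<close> is maximal: the error terms bound this maximum \<open>m\<close>
    by \<open>m * (card K * \<delta>)\<close>, which forces \<open>m = 0\<close>. Injectivity of
    \<open>v\<close>, independence, \<open>Z \<inter> T = {0}\<close> and the kernel of
    \<open>F\<close> below all follow from this.\<close>
  have coeff_zero: "d k = 0" if Zd: "(\<Sum>k\<in>K. d k *\<^sub>R v k) \<in> Z" and k: "k \<in> K" for d k
  proof -
    define m where "m = Max ((\<lambda>k. \<bar>d k\<bar>) ` K)"
    have "m \<in> (\<lambda>k. \<bar>d k\<bar>) ` K" unfolding m_def using fin k by (intro Max_in) auto
    then obtain j where j: "j \<in> K" "m = \<bar>d j\<bar>" by auto
    have le: "\<bar>d i\<bar> \<le> m" if "i \<in> K" for i
      unfolding m_def using fin that by (intro Max_ge) auto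
    have "0 = L j (\<Sum>k\<in>K. d k *\<^sub>R v k)" using Zd j by (simp add: Z_def)
    also have "\<dots> = (\<Sum>k\<in>K. d k * L j (v k))"
      using lin[OF j(1)] by (simp add: linear_sum linear_scale)
    finally have "(\<Sum>k\<in>K. d k * L j (v k)) = 0" by simp
    moreover have "(\<Sum>k\<in>K. d k * (if j = k then 1 else 0)) = d j"
      using fin j by (simp add: if_distrib cong: if_cong)
    ultimately have "- d j = (\<Sum>k\<in>K. d k * (L j (v k) - (if j = k then 1 else 0)))"
      by (simp add: right_diff_distrib sum_subtractf)
    then have "m = \<bar>\<Sum>k\<in>K. d k * (L j (v k) - (if j = k then 1 else 0))\<bar>"
      using j by (metis abs_minus_cancel)
    also have "\<dots> \<le> (\<Sum>k\<in>K. \<bar>d k\<bar> * \<bar>L j (v k) - (if j = k then 1 else 0)\<bar>)"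
      by (rule order_trans[OF sum_abs]) (simp add: abs_mult)
    also have "\<dots> \<le> (\<Sum>k\<in>K. m * \<delta>)"
      using le near[OF j(1)] j by (intro sum_mono mult_mono) auto
    also have "\<dots> = m * (real (card K) * \<delta>)" by simp
    finally have "m * (1 - real (card K) * \<delta>) \<le> 0" by (simp add: algebra_simps)
    then have "m \<le> 0" using small by (simp add: mult_le_0_iff)
    then show ?thesis using le[OF k] by simp
  qed
  have subZ: "subspace Z"
    unfolding Z_def subspace_def using lin by (auto simp: linear_0 linear_add linear_scale)
  then have zeroZ: "0 \<in> Z" by (rule subspace_0)
  have inj: "inj_on v K"
  proof (rule inj_onI, rule ccontr)
    fix j k assume jk: "j \<in> K" "k \<in> K" "v j = v k" "j \<noteq> k"
    have "(\<Sum>i\<in>K. ((if i = j then 1 else 0) - (if i = k then 1 else 0)) *\<^sub>R v i) = v j - v k"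
      using fin jk by (simp add: scaleR_left_diff_distrib sum_subtractf if_distrib[of "\<lambda>r. r *\<^sub>R _"] cong: if_cong)
    then show False
      using coeff_zero[of "\<lambda>i. (if i = j then 1 else 0) - (if i = k then 1 else 0)" j] jk zeroZ by simp
  qed
  have "independent (v ` K)"
  proof (rule independent_if_scalars_zero)
    fix f x assume "(\<Sum>x\<in>v ` K. f x *\<^sub>R x) = 0" and x: "x \<in> v ` K"
    then have "(\<Sum>k\<in>K. f (v k) *\<^sub>R v k) = 0" using inj by (simp add: sum.reindex)
    then show "f x = 0" using coeff_zero[of "\<lambda>k. f (v k)"] x zeroZ by auto
  qed (use fin in simp)
  then have dimT: "dim T = card K"
    unfolding T_def using inj by (simp add: dim_eq_card_independent card_image)
  have subT: "subspace T" unfolding T_def by simp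
  have T_sum: "\<exists>d. w = (\<Sum>k\<in>K. d k *\<^sub>R v k)" if "w \<in> T" for w
  proof -
    from that obtain u where "w = (\<Sum>x\<in>v ` K. u x *\<^sub>R x)"
      unfolding T_def using fin by (auto simp: span_finite)
    then have "w = (\<Sum>k\<in>K. u (v k) *\<^sub>R v k)" using inj by (simp add: sum.reindex)
    then show ?thesis by (rule exI[of _ "\<lambda>k. u (v k)"])
  qed
  have ZT: "Z \<inter> T = {0}"
  proof -
    have "w = 0" if "w \<in> Z" "w \<in> T" for w
      using T_sum[OF that(2)] coeff_zero that(1) by (metis (no_types, lifting) scaleR_zero_left sum.neutral)
    then show ?thesis using zeroZ subspace_0[OF subT] by auto
  qed
  \<comment> \<open>\<open>F\<close> maps into \<open>T\<close> and vanishes only on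
    \<open>Z\<close>, so it permutes \<open>T\<close>. Any \<open>x\<close> thus has some
    \<open>y\<close> in \<open>T\<close> with \<open>F x = F y\<close>, and
    \<open>x = (x - y) + y\<close> splits it along \<open>Z\<close> and \<open>T\<close>.\<close>
  define F where "F x = (\<Sum>k\<in>K. L k x *\<^sub>R v k)" for x
  have linF: "linear F"
    unfolding F_def using lin by (intro linear_compose_sum) (auto intro!: linearI simp: linear_add linear_scale algebra_simps)
  have F_T: "F x \<in> T" for x
    unfolding F_def T_def by (intro span_sum span_scale span_base) auto
  have F_Z: "x \<in> Z" if "F x = 0" for x
    using coeff_zero[of "\<lambda>k. L k x"] that zeroZ unfolding F_def Z_def by simp
  have "inj_on F T"
  proof (rule inj_onI)
    fix x y assume xy: "x \<in> T" "y \<in> T" "F x = F y"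
    then have "F (x - y) = 0" using linF by (simp add: linear_diff)
    then have "x - y \<in> Z \<inter> T" using F_Z xy subspace_diff[OF subT] by auto
    then show "x = y" using ZT by simp
  qed
  then have "dim (F ` T) = dim T"
    using linF subT by (intro dim_image_eq) (simp_all add: span_eq_iff[THEN iffD2])
  then have FT: "F ` T = T"
    using F_T linF subT by (intro subspace_dim_equal) (auto intro: linear_subspace_image)
  have "{x + y | x y. x \<in> Z \<and> y \<in> T} = UNIV"
  proof -
    have "\<exists>z\<in>Z. \<exists>y\<in>T. x = z + y" for x
    proof -
      from F_T[of x] FT obtain y where y: "y \<in> T" "F x = F y" by (metis imageE)
      then have "x - y \<in> Z" using linF by (intro F_Z) (simp add: linear_diff)
      then show ?thesis using y by (metis diff_add_cancel)
    qed
    then show ?thesis by blast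
  qed
  then show ?thesis
    using dim_sums_Int[OF subZ subT] dimT ZT by (simp add: Z_def)
qed

section \<open>Stochastic vectors and matrices\<close>

lemma stochastic_vector_le_1:
  "stochastic_vector p \<Longrightarrow> p $ i \<le> 1"
  unfolding stochastic_vector_def by (metis finite_class.finite_UNIV iso_tuple_UNIV_I member_le_sum)

lemma stochastic_vector_axis: "stochastic_vector (axis i 1)"
  by (simp add: stochastic_vector_def axis_def)

text \<open>The weights on \<open>S\<close> sum to at most 1. \<open>0 \<le> B\<close> is what
  allows \<open>S\<close> to be enlarged to \<open>UNIV\<close>; it does not follow from the bound
  on \<open>S\<close> if \<open>S\<close> is empty.\<close>

lemma stochastic_vector_abs_average_le:
  assumes p: "stochastic_vector p" and S: "\<And>i. i \<in> S \<Longrightarrow> \<bar>x i\<bar> \<le> B" and B: "0 \<le> B"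
  shows "\<bar>\<Sum>i\<in>S. p $ i * x i\<bar> \<le> B"
proof -
  have pos: "0 \<le> p $ i" for i using p by (simp add: stochastic_vector_def)
  have "\<bar>\<Sum>i\<in>S. p $ i * x i\<bar> \<le> (\<Sum>i\<in>S. p $ i * B)"
    using S pos by (intro order_trans[OF sum_abs] sum_mono) (auto simp: abs_mult intro!: mult_left_mono)
  also have "\<dots> \<le> (\<Sum>i\<in>UNIV. p $ i * B)"
    using pos B by (intro sum_mono2) auto
  also have "\<dots> = B" using p by (simp add: stochastic_vector_def flip: sum_distrib_right)
  finally show ?thesis .
qed

lemma row_stochastic_abs_le:
  assumes "row_stochastic M" "\<And>i. \<bar>x $ i\<bar> \<le> B"
  shows "\<bar>(M *v x) $ i\<bar> \<le> B"
proof -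
  have "0 \<le> B" using assms(2)[of i] by linarith
  then show ?thesis
    unfolding matrix_vector_mult_def
    using stochastic_vector_abs_average_le[of "M $ i" UNIV "\<lambda>j. x $ j" B] assms
    by (simp add: row_stochastic_def)
qed

lemma stochastic_vector_mult:
  assumes p: "stochastic_vector p" and M: "row_stochastic M"
  shows "stochastic_vector (p v* M)"
proof -
  have pos: "0 \<le> p $ i" "0 \<le> M $ i $ j" for i j
    using p M by (auto simp: row_stochastic_def stochastic_vector_def)
  have "(\<Sum>j\<in>UNIV. (p v* M) $ j) = (\<Sum>i\<in>UNIV. \<Sum>j\<in>UNIV. M $ i $ j * p $ i)"
    unfolding vector_matrix_mult_def by (subst sum.swap) (simp add: mult.commute)
  also have "\<dots> = 1"
    using p M by (simp add: row_stochastic_def stochastic_vector_def flip: sum_distrib_right)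
  finally show ?thesis
    using pos by (auto simp: stochastic_vector_def vector_matrix_mult_def intro!: sum_nonneg)
qed

lemma matrix_matrix_mult_row: "(M ** N) $ i = M $ i v* N"
  for M N :: "'a::comm_semiring_1 ^ 'n ^ 'n"
  by (simp add: vec_eq_iff matrix_matrix_mult_def vector_matrix_mult_def mult.commute)

section \<open>Transition matrices and opinion trajectories\<close>

lemma row_stochastic_forward_product:
  fixes A :: "nat \<Rightarrow> real ^ 'n ^ 'n"
  assumes "\<And>t. row_stochastic (A t)"
  shows "row_stochastic (forward_product A \<tau> m)"
proof (induction m)
  case 0
  have "(mat 1 :: real ^ 'n ^ 'n) $ i = axis i 1" for i :: 'n
    by (simp add: vec_eq_iff mat_def axis_def)
  then show ?case by (simp add: row_stochastic_def stochastic_vector_axis)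
next
  case (Suc m)
  then show ?case
    using assms[of "\<tau> + m"]
    by (simp add: row_stochastic_def matrix_matrix_mult_row stochastic_vector_mult)
qed

text \<open>The recursion adds the latest factor on the left; the backward equation of absolute
  probability sequences needs the earliest one split off on the right.\<close>

lemma forward_product_Suc_right:
  "forward_product A \<tau> (Suc m) = forward_product A (Suc \<tau>) m ** A \<tau>"
proof (induction m)
  case (Suc m)
  have "forward_product A \<tau> (Suc (Suc m)) = A (\<tau> + Suc m) ** forward_product A \<tau> (Suc m)"
    by simp
  then show ?case by (simp only: Suc) (simp add: matrix_mul_assoc)
qed simp

lemma opinion_trajectory_state_transition:
  "opinion_trajectory A \<tau> (\<lambda>t. state_transition A t \<tau> *v v)"
  by (simp add: opinion_trajectory_def state_transition_def Suc_diff_le matrix_vector_mul_assoc)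

lemma opinion_trajectory_abs_le:
  assumes "\<And>t. row_stochastic (A t)" "opinion_trajectory A t0 x" "\<And>i. \<bar>x t0 $ i\<bar> \<le> B" "t0 \<le> t"
  shows "\<bar>x t $ i\<bar> \<le> B"
  using assms(4)
proof (induction t arbitrary: i rule: dec_induct)
  case (step n)
  then show ?case
    using row_stochastic_abs_le[OF assms(1), of "x n" B n i] assms(2)
    by (simp add: opinion_trajectory_def)
qed (rule assms(3))

section \<open>Absolute probability sequences and the null space\<close>

text \<open>Moving \<open>A n\<close> from \<open>x n\<close> over to \<open>p (n + 1)\<close> gives
  \<open>p n\<close>. This conserved average ties the initial vector to the limiting
  opinions.\<close>

lemma absolute_probability_inner_const:
  assumes p: "absolute_probability A p" and x: "opinion_trajectory A t0 x" and "t0 \<le> t"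
  shows "p t \<bullet> x t = p t0 \<bullet> x t0"
  using assms(3)
proof (induction t rule: dec_induct)
  case (step n)
  have "p (Suc n) \<bullet> x (Suc n) = (p (Suc n) v* A n) \<bullet> x n"
    using x step by (simp add: opinion_trajectory_def dot_lmul_matrix)
  also have "\<dots> = p n \<bullet> x n"
    using p by (simp add: absolute_probability_def)
  finally show ?case using step by simp
qed simp

lemma compact_stochastic_vectors: "compact {p :: real ^ 'n. stochastic_vector p}"
proof (rule compact_Int_closed[of "cbox 0 1" "{p. stochastic_vector p}", THEN back_subst[of compact]])
  have "closed ({p :: real ^ 'n. \<forall>i. 0 \<le> p $ i} \<inter> {p. (\<Sum>i\<in>UNIV. p $ i) = 1})"
    by (intro closed_Int closed_Collect_all closed_Collect_le closed_Collect_eq continuous_intros)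
  then show "closed {p :: real ^ 'n. stochastic_vector p}"
    by (simp add: stochastic_vector_def Collect_conj_eq)
  show "cbox 0 1 \<inter> {p. stochastic_vector p} = {p :: real ^ 'n. stochastic_vector p}"
    using stochastic_vector_le_1 by (auto simp: mem_box_cart) (simp add: stochastic_vector_def)
qed simp

text \<open>Kolmogorov's construction: the rows of the transition matrices at a sequence of times going
  to infinity accumulate, simultaneously for all initial times, at an absolute probability
  sequence.\<close>

lemma absolute_probability_accumulation:
  fixes A :: "nat \<Rightarrow> real ^ 'n ^ 'n"
  assumes A: "\<And>t. row_stochastic (A t)" and T: "\<And>n. n \<le> T n"
  obtains p r where "absolute_probability A p" "strict_mono (r :: nat \<Rightarrow> nat)"
    "\<And>s. (\<lambda>n. state_transition A (T (r n)) s $ i) \<longlonglongrightarrow> p s"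
proof -
  \<comment> \<open>By Tychonoff the product over all initial times \<open>s\<close> is compact, and
    sequentially so because the times are countable. One subsequence \<open>r\<close> then serves
    all \<open>s\<close> at once.\<close>
  define C :: "(nat \<Rightarrow> real ^ 'n) set" where "C = (\<Pi>\<^sub>E s\<in>UNIV. {p. stochastic_vector p})"
  have "compact C"
    using compactin_PiE[of "\<lambda>_. euclidean" UNIV "\<lambda>_::nat. {p :: real ^ 'n. stochastic_vector p}"]
    unfolding C_def by (simp add: euclidean_product_topology compact_stochastic_vectors)
  then have C: "seq_compact C" by (rule compact_imp_seq_compact)
  define f where "f n s = state_transition A (T n) s $ i" for n s
  \<comment> \<open>For \<open>s > T n\<close> the truncated difference makes the transition matrix
    the identity, whose rows are stochastic as well.\<close>
  have "\<forall>n. f n \<in> C"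
    using row_stochastic_forward_product[of A] A
    by (auto simp: f_def C_def state_transition_def row_stochastic_def)
  with C obtain p r where p: "p \<in> C" and r: "strict_mono (r :: nat \<Rightarrow> nat)"
    and lim: "(f \<circ> r) \<longlonglongrightarrow> p"
    by (rule seq_compactE)
  have lims: "(\<lambda>n. state_transition A (T (r n)) s $ i) \<longlonglongrightarrow> p s" for s
  proof -
    have "continuous_on UNIV (\<lambda>f :: nat \<Rightarrow> real ^ 'n. f s)"
      by (rule continuous_on_product_coordinates)
    from continuous_on_tendsto_compose[OF this lim] show ?thesis by (simp add: o_def f_def)
  qed
  have "p (s + 1) v* A s = p s" for s
  proof (rule LIMSEQ_unique)
    show "(\<lambda>n. state_transition A (T (r n)) (s + 1) $ i v* A s) \<longlonglongrightarrow> p (s + 1) v* A s"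
      unfolding vector_matrix_mult_def
      by (intro vec_tendstoI) (simp, intro tendsto_sum tendsto_mult tendsto_const tendsto_vec_nth lims)
    \<comment> \<open>Once \<open>T (r n)\<close> exceeds \<open>s\<close>, the earliest factor
      \<open>A s\<close> can be split off. This holds for all large \<open>n\<close> because
      \<open>n \<le> r n \<le> T (r n)\<close>.\<close>
    have "\<forall>\<^sub>F n in sequentially. state_transition A (T (r n)) (s + 1) $ i v* A s
        = state_transition A (T (r n)) s $ i"
    proof (rule eventually_sequentiallyI[of "Suc s"])
      fix n assume "Suc s \<le> n"
      then have "Suc s \<le> T (r n)"
        using T[of "r n"] seq_suble[OF r, of n] by linarith
      then have "T (r n) - s = Suc (T (r n) - Suc s)" by simp
      then show "state_transition A (T (r n)) (s + 1) $ i v* A s = state_transition A (T (r n)) s $ i"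
        unfolding state_transition_def
        by (simp only: forward_product_Suc_right matrix_matrix_mult_row) simp
    qed
    then show "(\<lambda>n. state_transition A (T (r n)) (s + 1) $ i v* A s) \<longlonglongrightarrow> p s"
      using lims[of s] tendsto_cong by fast
  qed
  then have "absolute_probability A p"
    using p by (auto simp: absolute_probability_def C_def)
  then show thesis using r lims that by blast
qed

text \<open>If the trajectory tends to 0, so does its conserved average. Conversely, if coordinate
  \<open>i\<close> stays at distance \<open>e\<close> from 0 along times \<open>T n\<close>, then
  row \<open>i\<close> of the transition matrices at these times accumulates at some
  \<open>p\<close> with \<open>e \<le> \<bar>p \<tau> \<bullet> v\<bar>\<close>.\<close>

lemma chain_null_iff_absolute_probability:
  fixes A :: "nat \<Rightarrow> real ^ 'n ^ 'n"
  assumes A: "\<And>t. row_stochastic (A t)"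
  shows "v \<in> chain_null A \<tau> \<longleftrightarrow> (\<forall>p. absolute_probability A p \<longrightarrow> p \<tau> \<bullet> v = 0)"
proof (intro iffI allI impI)
  fix p assume v: "v \<in> chain_null A \<tau>" and p: "absolute_probability A p"
  define x where "x t = state_transition A t \<tau> *v v" for t
  have traj: "opinion_trajectory A \<tau> x"
    unfolding x_def by (rule opinion_trajectory_state_transition)
  have x0: "x \<longlonglongrightarrow> 0" using v by (simp add: chain_null_def x_def[abs_def])
  have sp: "stochastic_vector (p t)" for t using p by (simp add: absolute_probability_def)
  have "(\<lambda>t. p t \<bullet> x t) \<longlonglongrightarrow> 0"
  proof (rule Lim_null_comparison)
    show "\<forall>\<^sub>F t in sequentially. norm (p t \<bullet> x t) \<le> norm (x t)"
      using stochastic_vector_abs_average_le[OF sp, of UNIV, OF component_le_norm_cart]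
      by (intro always_eventually allI) (simp add: inner_vec_def)
    show "(\<lambda>t. norm (x t)) \<longlonglongrightarrow> 0" using x0 by (simp add: tendsto_norm_zero)
  qed
  moreover have "(\<lambda>t. p t \<bullet> x t) \<longlonglongrightarrow> p \<tau> \<bullet> x \<tau>"
    by (rule tendsto_eventually, rule eventually_sequentiallyI[of \<tau>])
      (rule absolute_probability_inner_const[OF p traj])
  ultimately show "p \<tau> \<bullet> v = 0"
    using LIMSEQ_unique by (fastforce simp: x_def state_transition_def)
next
  assume ortho: "\<forall>p. absolute_probability A p \<longrightarrow> p \<tau> \<bullet> v = 0"
  have "(\<lambda>t. (state_transition A t \<tau> *v v) $ i) \<longlonglongrightarrow> 0" for i
  proof (rule ccontr)
    assume "\<not> ?thesis"
    then obtain e where e: "e > 0" "\<And>n. \<exists>t\<ge>n. e \<le> \<bar>(state_transition A t \<tau> *v v) $ i\<bar>"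
      unfolding LIMSEQ_iff by (auto simp: not_less)
    then obtain T where T: "\<And>n. n \<le> T n" "\<And>n. e \<le> \<bar>(state_transition A (T n) \<tau> *v v) $ i\<bar>"
      by metis
    obtain p r where p: "absolute_probability A p"
      and lims: "\<And>s. (\<lambda>n. state_transition A (T (r n)) s $ i) \<longlonglongrightarrow> p s"
      using absolute_probability_accumulation[of A T i] A T(1) by metis
    have "(\<lambda>n. \<bar>state_transition A (T (r n)) \<tau> $ i \<bullet> v\<bar>) \<longlonglongrightarrow> \<bar>p \<tau> \<bullet> v\<bar>"
      by (intro tendsto_intros lims)
    then have "e \<le> \<bar>p \<tau> \<bullet> v\<bar>"
      using T(2) by (intro LIMSEQ_le_const) (auto simp: matrix_vector_mult_def inner_vec_def)
    then show False using ortho p e(1) by auto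
  qed
  then show "v \<in> chain_null A \<tau>"
    unfolding chain_null_def by (auto intro!: vec_tendstoI)
qed

section \<open>Flows between jets and the exchange of mass\<close>

text \<open>The real summand of \<open>total_flow\<close>, which turns finiteness of an
  \<open>ennreal\<close> series into summability.\<close>

definition flow_rate ::
    "(nat \<Rightarrow> real ^ 'n ^ 'n) \<Rightarrow> (nat \<Rightarrow> real ^ 'n) \<Rightarrow> 'n jet \<Rightarrow> 'n jet \<Rightarrow> nat \<Rightarrow> real" where
  "flow_rate A p Js Jk t = (\<Sum>i\<in>Jk t. \<Sum>j\<in>Js (t + 1). flow A p i j t)
                         + (\<Sum>i\<in>Js t. \<Sum>j\<in>Jk (t + 1). flow A p i j t)"

lemma flow_nonneg:
  "row_stochastic (A t) \<Longrightarrow> absolute_probability A p \<Longrightarrow> 0 \<le> flow A p i j t"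
  by (simp add: flow_def row_stochastic_def absolute_probability_def stochastic_vector_def)

lemma flow_rate_nonneg:
  "(\<And>t. row_stochastic (A t)) \<Longrightarrow> absolute_probability A p \<Longrightarrow> 0 \<le> flow_rate A p Js Jk t"
  by (auto simp: flow_rate_def intro!: add_nonneg_nonneg sum_nonneg flow_nonneg)

lemma total_flow_finite_iff:
  assumes "\<And>t. row_stochastic (A t)" "absolute_probability A p"
  shows "total_flow A p Js Jk < \<infinity> \<longleftrightarrow> summable (flow_rate A p Js Jk)"
proof -
  have nn: "0 \<le> flow_rate A p Js Jk t" for t by (rule flow_rate_nonneg[OF assms])
  have "total_flow A p Js Jk = (\<Sum>t. ennreal (flow_rate A p Js Jk t))"
    unfolding total_flow_def flow_rate_def ..
  then show ?thesis
    using summable_suminf_not_top[OF nn] ennreal_suminf_neq_top[OF _ nn] by (auto simp: less_top)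
qed

lemma sum_jet_partition:
  fixes g :: "'n::finite \<Rightarrow> real"
  assumes "jet_partition c J"
  shows "sum g UNIV = (\<Sum>k\<le>c. sum g (J k t))"
proof -
  have "sum g (\<Union>k\<le>c. J k t) = (\<Sum>k\<le>c. sum g (J k t))"
    using assms unfolding jet_partition_def disjoint_family_on_def
    by (intro sum.UNION_disjoint) auto
  then show ?thesis using assms by (simp add: jet_partition_def)
qed

text \<open>At every time the complement of a jet is the disjoint union of the other jets,
  \<open>J 0\<close> included. So finite pairwise flows will bound the whole exchange of a jet with
  its surroundings.\<close>

lemma flow_rate_jet_compl:
  assumes J: "jet_partition c J" and k: "k \<le> c"
  shows "flow_rate A p (J k) (jet_compl (J k)) t = (\<Sum>s\<in>{..c} - {k}. flow_rate A p (J k) (J s) t)"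
proof -
  have sum_compl: "sum g (jet_compl (J k) t) = (\<Sum>s\<in>{..c} - {k}. sum g (J s t))"
    for t and g :: "_ \<Rightarrow> real"
  proof -
    have "sum g (jet_compl (J k) t) = sum g UNIV - sum g (J k t)"
      unfolding jet_compl_def by (rule sum_diff) auto
    also have "\<dots> = (\<Sum>s\<in>{..c} - {k}. sum g (J s t))"
      unfolding sum_jet_partition[OF J, of g t] using k by (subst sum.remove[of _ k]) auto
    finally show ?thesis .
  qed
  have swap: "(\<Sum>i\<in>J k t. \<Sum>s\<in>{..c} - {k}. g i s) = (\<Sum>s\<in>{..c} - {k}. \<Sum>i\<in>J k t. g i s)"
    for g :: "_ \<Rightarrow> _ \<Rightarrow> real" by (rule sum.swap)
  show ?thesis
    unfolding flow_rate_def sum.distrib by (simp only: sum_compl swap)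
qed

lemma flow_sum:
  "absolute_probability A p \<Longrightarrow> (\<Sum>j\<in>UNIV. flow A p i j t) = p t $ i"
  unfolding absolute_probability_def flow_def vector_matrix_mult_def
  by (auto simp: vec_eq_iff mult.commute)

text \<open>Both moments are sums of \<open>x t $ i\<close> times the flow from \<open>i\<close> to
  \<open>j\<close>: the new one over pairs ending in \<open>S (t + 1)\<close>, the old one over
  pairs starting in \<open>S t\<close>. Pairs with both properties cancel, and the rest cross the
  border of \<open>S\<close>.\<close>

lemma jet_moment_increment_le:
  assumes A: "\<And>t. row_stochastic (A t)" and p: "absolute_probability A p"
    and x: "x (t + 1) = A t *v x t" and bd: "\<And>i. \<bar>x t $ i\<bar> \<le> 1"
  shows "\<bar>(\<Sum>i\<in>S (t + 1). p (t + 1) $ i * x (t + 1) $ i) - (\<Sum>i\<in>S t. p t $ i * x t $ i)\<bar>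
    \<le> flow_rate A p S (jet_compl S) t"
proof -
  let ?f = "\<lambda>i j. flow A p i j t"
  have nn: "0 \<le> ?f i j" for i j by (rule flow_nonneg[OF A p])
  have split: "sum g UNIV = sum g U + sum g (- U)" for U and g :: "'a \<Rightarrow> real"
    by (metis Compl_disjoint Compl_partition2 finite sum.union_disjoint sup_commute)
  have "(\<Sum>j\<in>S (t + 1). p (t + 1) $ j * x (t + 1) $ j)
      = (\<Sum>j\<in>S (t + 1). \<Sum>i\<in>UNIV. x t $ i * ?f i j)"
    by (simp add: x[simplified] matrix_vector_mult_def flow_def sum_distrib_left mult_ac)
  also have "\<dots> = (\<Sum>i\<in>UNIV. x t $ i * (\<Sum>j\<in>S (t + 1). ?f i j))"
    by (subst sum.swap) (simp add: sum_distrib_left)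
  also have "\<dots> = (\<Sum>i\<in>S t. x t $ i * (\<Sum>j\<in>S (t + 1). ?f i j))
      + (\<Sum>i\<in>- S t. x t $ i * (\<Sum>j\<in>S (t + 1). ?f i j))"
    by (rule split)
  finally have new: "(\<Sum>j\<in>S (t + 1). p (t + 1) $ j * x (t + 1) $ j) = \<dots>" .
  have old: "(\<Sum>i\<in>S t. p t $ i * x t $ i) = (\<Sum>i\<in>S t. x t $ i * (\<Sum>j\<in>S (t + 1). ?f i j))
      + (\<Sum>i\<in>S t. x t $ i * (\<Sum>j\<in>- S (t + 1). ?f i j))"
    unfolding sum.distrib[symmetric] distrib_left[symmetric] split[of _ "S (t + 1)", symmetric] flow_sum[OF p]
    by (simp add: mult.commute)
  have weighted: "\<bar>\<Sum>i\<in>U. x t $ i * (\<Sum>j\<in>W. ?f i j)\<bar> \<le> (\<Sum>i\<in>U. \<Sum>j\<in>W. ?f i j)" for U W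
    using bd nn
    by (intro order_trans[OF sum_abs] sum_mono)
      (auto simp: abs_mult sum_nonneg intro!: mult_left_le_one_le)
  show ?thesis
    unfolding new old flow_rate_def jet_compl_def Compl_eq_Diff_UNIV[symmetric]
    using weighted[of "S (t + 1)" "- S t"] weighted[of "- S (t + 1)" "S t"] by linarith
qed

text \<open>The increments telescope. The bound is a tail of a convergent series that does not
  depend on the trajectory, hence small for every trajectory with a late start.\<close>

lemma jet_moment_variation_le:
  assumes A: "\<And>t. row_stochastic (A t)" and p: "absolute_probability A p"
    and x: "opinion_trajectory A \<tau> x" and bd: "\<And>i. \<bar>x \<tau> $ i\<bar> \<le> 1"
    and fl: "summable (flow_rate A p S (jet_compl S))" and t: "\<tau> \<le> t"
  shows "\<bar>(\<Sum>i\<in>S t. p t $ i * x t $ i) - (\<Sum>i\<in>S \<tau>. p \<tau> $ i * x \<tau> $ i)\<bar>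
    \<le> (\<Sum>n. flow_rate A p S (jet_compl S) (n + \<tau>))"
proof -
  let ?f = "flow_rate A p S (jet_compl S)"
  let ?m = "\<lambda>t. \<Sum>i\<in>S t. p t $ i * x t $ i"
  have "\<bar>?m (\<tau> + n) - ?m \<tau>\<bar> \<le> (\<Sum>i<n. ?f (i + \<tau>))" for n
  proof (induction n)
    case (Suc n)
    have "\<bar>?m (\<tau> + n + 1) - ?m (\<tau> + n)\<bar> \<le> ?f (\<tau> + n)"
      using x opinion_trajectory_abs_le[OF A x bd, of "\<tau> + n"]
      by (intro jet_moment_increment_le[OF A p]) (auto simp: opinion_trajectory_def)
    with Suc show ?case by (simp add: add.commute)
  qed simp
  also have "(\<Sum>i<n. ?f (i + \<tau>)) \<le> (\<Sum>i. ?f (i + \<tau>))" for n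
    using fl flow_rate_nonneg[OF A p] by (intro sum_le_suminf) (auto simp: summable_iff_shift)
  finally have "\<bar>?m (\<tau> + (t - \<tau>)) - ?m \<tau>\<bar> \<le> (\<Sum>i. ?f (i + \<tau>))" .
  with t show ?thesis by simp
qed

section \<open>Limits of opinions along a jet\<close>

text \<open>The condition of \<open>sonin_decomposition\<close> on opinions, for one jet. It is
  vacuous at \<open>t0\<close> if \<open>S t\<close> is empty for some \<open>t \<ge> t0\<close>, so
  nonemptiness is assumed separately below.\<close>

definition consensus_jet :: "(nat \<Rightarrow> real ^ 'n ^ 'n) \<Rightarrow> 'n jet \<Rightarrow> bool" where
  "consensus_jet A S \<longleftrightarrow> (\<forall>t0 x. opinion_trajectory A t0 x \<longrightarrow>
     (\<exists>l. \<forall>i. (\<forall>t\<ge>t0. i t \<in> S t) \<longrightarrow> (\<lambda>t. x t $ i t) \<longlonglongrightarrow> l))"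

text \<open>One fixed selection computes the limit. The value is meaningful for consensus jets that
  are eventually nonempty.\<close>

definition jet_limit :: "'n jet \<Rightarrow> (nat \<Rightarrow> real ^ 'n) \<Rightarrow> real" where
  "jet_limit S x = lim (\<lambda>t. x t $ (SOME i. i \<in> S t))"

lemma jet_limit_selection:
  assumes conv: "consensus_jet A S"
    and ne: "\<forall>\<^sub>F t in sequentially. S t \<noteq> {}"
    and x: "opinion_trajectory A t0 x"
    and i: "\<forall>\<^sub>F t in sequentially. i t \<in> S t"
  shows "(\<lambda>t. x t $ i t) \<longlonglongrightarrow> jet_limit S x"
proof -
  let ?sel = "\<lambda>t. SOME i. i \<in> S t"
  have "\<forall>\<^sub>F t in sequentially. i t \<in> S t \<and> ?sel t \<in> S t"
    using i ne by eventually_elim (simp add: some_in_eq)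
  then obtain t1 where t1: "\<And>t. t1 \<le> t \<Longrightarrow> i t \<in> S t \<and> ?sel t \<in> S t"
    unfolding eventually_sequentially by blast
  \<comment> \<open>The trajectory is restarted at a time from which both selections stay in
    \<open>S\<close>, since \<open>consensus_jet\<close> asks for membership from the initial time
    on.\<close>
  have "opinion_trajectory A (max t0 t1) x" using x by (simp add: opinion_trajectory_def)
  with conv obtain l
    where l: "\<And>i. \<forall>t\<ge>max t0 t1. i t \<in> S t \<Longrightarrow> (\<lambda>t. x t $ i t) \<longlonglongrightarrow> l"
    unfolding consensus_jet_def by blast
  have "(\<lambda>t. x t $ ?sel t) \<longlonglongrightarrow> l" using t1 by (intro l) simp
  then have "jet_limit S x = l" unfolding jet_limit_def by (rule limI)
  then show ?thesis using l[of i] t1 by simp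
qed

text \<open>A selection that takes a vertex at distance at least \<open>e\<close> from the limit
  whenever there is one, and any vertex of \<open>S t\<close> otherwise, still converges. Hence such
  far vertices disappear eventually.\<close>

lemma jet_limit_uniform:
  assumes conv: "consensus_jet A S"
    and ne: "\<forall>\<^sub>F t in sequentially. S t \<noteq> {}"
    and x: "opinion_trajectory A t0 x" and e: "0 < e"
  shows "\<forall>\<^sub>F t in sequentially. \<forall>i\<in>S t. \<bar>x t $ i - jet_limit S x\<bar> < e"
proof -
  let ?far = "\<lambda>t i. i \<in> S t \<and> e \<le> \<bar>x t $ i - jet_limit S x\<bar>"
  define i where "i t = (if \<exists>i. ?far t i then SOME i. ?far t i else SOME i. i \<in> S t)" for t
  have far: "?far t (i t)" if "?far t j" for t j
  proof -
    have "?far t (SOME i. ?far t i)" using that by (rule someI)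
    then show ?thesis using that unfolding i_def by (smt (verit))
  qed
  have "i t \<in> S t" if "S t \<noteq> {}" for t
  proof (cases "\<exists>j. ?far t j")
    case True
    then show ?thesis using far by blast
  next
    case False
    then have "i t = (SOME i. i \<in> S t)" unfolding i_def by (rule if_not_P)
    then show ?thesis using that by (simp add: some_in_eq)
  qed
  with ne have "\<forall>\<^sub>F t in sequentially. i t \<in> S t"
    by (rule eventually_mono)
  then have "(\<lambda>t. x t $ i t) \<longlonglongrightarrow> jet_limit S x"
    by (rule jet_limit_selection[OF conv ne x])
  then have "\<forall>\<^sub>F t in sequentially. dist (x t $ i t) (jet_limit S x) < e"
    using e by (rule tendstoD)
  then show ?thesis
  proof eventually_elim
    case (elim t)
    then have "\<not> ?far t j" for j
      using far[of j t] by (auto simp: dist_real_def)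
    then show ?case by (simp add: not_le)
  qed
qed

lemma jet_moment_tendsto:
  assumes p: "\<And>t. stochastic_vector (p t)" and m: "(\<lambda>t. \<Sum>i\<in>S t. p t $ i) \<longlonglongrightarrow> m"
    and conv: "consensus_jet A S" and ne: "\<forall>\<^sub>F t in sequentially. S t \<noteq> {}"
    and x: "opinion_trajectory A t0 x"
  shows "(\<lambda>t. \<Sum>i\<in>S t. p t $ i * x t $ i) \<longlonglongrightarrow> m * jet_limit S x"
proof -
  define l where "l = jet_limit S x"
  have "(\<lambda>t. \<Sum>i\<in>S t. p t $ i * (x t $ i - l)) \<longlonglongrightarrow> 0"
  proof (rule tendstoI)
    fix e :: real assume e: "0 < e"
    then have "\<forall>\<^sub>F t in sequentially. \<forall>i\<in>S t. \<bar>x t $ i - l\<bar> < e / 2"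
      unfolding l_def by (intro jet_limit_uniform[OF conv ne x]) simp
    then show "\<forall>\<^sub>F t in sequentially. dist (\<Sum>i\<in>S t. p t $ i * (x t $ i - l)) 0 < e"
    proof eventually_elim
      case (elim t)
      then have "\<bar>\<Sum>i\<in>S t. p t $ i * (x t $ i - l)\<bar> \<le> e / 2"
        using e by (intro stochastic_vector_abs_average_le[OF p]) (auto simp: less_imp_le)
      then show ?case using e by simp
    qed
  qed
  from tendsto_add[OF this tendsto_mult_right[OF m, of l]] show ?thesis
    by (simp add: sum_distrib_right right_diff_distrib sum_subtractf l_def)
qed

text \<open>This serves \<open>J 0\<close> and the negligible jets: opinions may fail to converge
  there, but they are bounded while the mass vanishes.\<close>

lemma jet_moment_tendsto_0:
  assumes p: "\<And>t. stochastic_vector (p t)" and m: "(\<lambda>t. \<Sum>i\<in>S t. p t $ i) \<longlonglongrightarrow> 0"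
    and bd: "\<forall>\<^sub>F t in sequentially. \<forall>i. \<bar>x t $ i\<bar> \<le> B"
  shows "(\<lambda>t. \<Sum>i\<in>S t. p t $ i * x t $ i) \<longlonglongrightarrow> 0"
proof (rule Lim_null_comparison)
  show "\<forall>\<^sub>F t in sequentially. norm (\<Sum>i\<in>S t. p t $ i * x t $ i) \<le> (\<Sum>i\<in>S t. p t $ i) * B"
    using bd
  proof eventually_elim
    case (elim t)
    have "\<bar>\<Sum>i\<in>S t. p t $ i * x t $ i\<bar> \<le> (\<Sum>i\<in>S t. p t $ i * B)"
      using elim p[of t] unfolding stochastic_vector_def
      by (intro order_trans[OF sum_abs] sum_mono) (auto simp: abs_mult intro!: mult_left_mono)
    then show ?case by (simp add: sum_distrib_right)
  qed
  show "(\<lambda>t. (\<Sum>i\<in>S t. p t $ i) * B) \<longlonglongrightarrow> 0"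
    using tendsto_mult_right[OF m, of B] by simp
qed

section \<open>Mass and flow of the jets of a decomposition\<close>

lemma sonin_flow_compl_summable:
  assumes A: "\<And>t. row_stochastic (A t)" and D: "sonin_decomposition A c J"
    and k: "k \<le> c" and p: "absolute_probability A p"
  shows "summable (flow_rate A p (J k) (jet_compl (J k)))"
proof -
  have part: "jet_partition c J" using D by (simp add: sonin_decomposition_def)
  have "summable (flow_rate A p (J k) (J s))" if "s \<in> {..c} - {k}" for s
    using D p k that unfolding total_flow_finite_iff[OF A p, symmetric] sonin_decomposition_def
    by auto
  then have "summable (\<lambda>t. \<Sum>s\<in>{..c} - {k}. flow_rate A p (J k) (J s) t)"
    by (intro summable_sum)
  moreover have "flow_rate A p (J k) (jet_compl (J k)) =
      (\<lambda>t. \<Sum>s\<in>{..c} - {k}. flow_rate A p (J k) (J s) t)"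
    by (rule ext) (rule flow_rate_jet_compl[OF part k])
  ultimately show ?thesis by simp
qed

lemma sonin_mass_convergent:
  assumes "sonin_decomposition A c J" "k \<in> {1..c}" "absolute_probability A p"
  shows "\<exists>m. (\<lambda>t. \<Sum>i\<in>J k t. p t $ i) \<longlonglongrightarrow> m"
proof -
  have "\<forall>k\<in>{1..c}. \<forall>p. absolute_probability A p \<longrightarrow> (\<exists>m. (\<lambda>t. \<Sum>i\<in>J k t. p t $ i) \<longlonglongrightarrow> m)"
    using assms(1) unfolding sonin_decomposition_def by simp
  with assms(2,3) show ?thesis by blast
qed

text \<open>Finite pairwise flows add up to a finite flow between the jet and its complement, so the
  limits of the masses decide.\<close>

lemma sonin_negligible_jet_iff:
  assumes A: "\<And>t. row_stochastic (A t)" and D: "sonin_decomposition A c J" and k: "k \<le> c"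
  shows "negligible_jet A (J k) \<longleftrightarrow>
    (\<forall>p. absolute_probability A p \<longrightarrow> (\<lambda>t. \<Sum>i\<in>J k t. p t $ i) \<longlonglongrightarrow> 0)"
proof -
  have "total_flow A p (J k) (jet_compl (J k)) < \<infinity>" if "absolute_probability A p" for p
    using total_flow_finite_iff[OF A that] sonin_flow_compl_summable[OF A D k that] by simp
  then show ?thesis unfolding negligible_jet_def by blast
qed

text \<open>A jet carrying mass in the limit is eventually nonempty, so that the limits of the opinions
  along it are not vacuous.\<close>

lemma sonin_jet_limit:
  assumes A: "\<And>t. row_stochastic (A t)" and D: "sonin_decomposition A c J"
    and k: "k \<in> {1..c}" and nn: "\<not> negligible_jet A (J k)"
  shows "\<forall>\<^sub>F t in sequentially. J k t \<noteq> {}"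
    and "consensus_jet A (J k)"
    and "\<exists>p m. absolute_probability A p \<and> 0 < m \<and> (\<lambda>t. \<Sum>i\<in>J k t. p t $ i) \<longlonglongrightarrow> m"
proof -
  show "consensus_jet A (J k)"
    using D k unfolding sonin_decomposition_def consensus_jet_def by simp
  obtain p where p: "absolute_probability A p"
    and not0: "\<not> (\<lambda>t. \<Sum>i\<in>J k t. p t $ i) \<longlonglongrightarrow> 0"
    using sonin_negligible_jet_iff[OF A D, of k] nn k by auto
  \<comment> \<open>The masses under \<open>p\<close> converge and are nonnegative, so not tending
    to 0 means having a positive limit.\<close>
  obtain m where m: "(\<lambda>t. \<Sum>i\<in>J k t. p t $ i) \<longlonglongrightarrow> m"
    using sonin_mass_convergent[OF D k p] by blast
  have "0 \<le> m"
    using p by (intro LIMSEQ_le_const[OF m])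
      (auto simp: absolute_probability_def stochastic_vector_def intro!: sum_nonneg)
  then have "0 < m" using not0 m by (cases "m = 0") auto
  then show "\<exists>p m. absolute_probability A p \<and> 0 < m \<and> (\<lambda>t. \<Sum>i\<in>J k t. p t $ i) \<longlonglongrightarrow> m"
    using p m by blast
  have "\<forall>\<^sub>F t in sequentially. 0 < (\<Sum>i\<in>J k t. p t $ i)"
    using m \<open>0 < m\<close> by (rule order_tendstoD)
  then show "\<forall>\<^sub>F t in sequentially. J k t \<noteq> {}"
    by eventually_elim auto
qed

section \<open>Limits along jets as functionals of the initial vector\<close>

lemma sonin_chain_null:
  assumes A: "\<And>t. row_stochastic (A t)" and D: "sonin_decomposition A c J"
  shows "chain_null A \<tau> = {v. \<forall>k\<in>{k \<in> {1..c}. \<not> negligible_jet A (J k)}.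
    jet_limit (J k) (\<lambda>t. state_transition A t \<tau> *v v) = 0}"
proof (intro set_eqI iffI)
  fix v assume v: "v \<in> chain_null A \<tau>"
  define x where "x t = state_transition A t \<tau> *v v" for t
  have x0: "x \<longlonglongrightarrow> 0" using v by (simp add: chain_null_def x_def[abs_def])
  have "(\<lambda>t. x t $ i t) \<longlonglongrightarrow> 0" for i
    by (rule Lim_null_comparison[OF _ tendsto_norm_zero[OF x0]]) (simp add: component_le_norm_cart)
  then have "jet_limit S x = 0" for S
    unfolding jet_limit_def by (intro limI)
  then show "v \<in> {v. \<forall>k\<in>{k \<in> {1..c}. \<not> negligible_jet A (J k)}.
      jet_limit (J k) (\<lambda>t. state_transition A t \<tau> *v v) = 0}"
    by (simp add: x_def[abs_def])
next
  fix v assume v: "v \<in> {v. \<forall>k\<in>{k \<in> {1..c}. \<not> negligible_jet A (J k)}.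
      jet_limit (J k) (\<lambda>t. state_transition A t \<tau> *v v) = 0}"
  define x where "x t = state_transition A t \<tau> *v v" for t
  have traj: "opinion_trajectory A \<tau> x"
    unfolding x_def by (rule opinion_trajectory_state_transition)
  have "\<bar>x t $ i\<bar> \<le> norm (x \<tau>)" if "\<tau> \<le> t" for t i
    by (rule opinion_trajectory_abs_le[OF A traj component_le_norm_cart that])
  then have bd: "\<forall>\<^sub>F t in sequentially. \<forall>i. \<bar>x t $ i\<bar> \<le> norm (x \<tau>)"
    unfolding eventually_sequentially by blast
  have part: "jet_partition c J" using D by (simp add: sonin_decomposition_def)
  have "p \<tau> \<bullet> v = 0" if p: "absolute_probability A p" for p
  proof -
    have sp: "stochastic_vector (p t)" for t using p by (simp add: absolute_probability_def)
    \<comment> \<open>The conserved average is the sum of these moments over all jets. Each vanishes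
      in the limit, either with the mass of the jet or with the limit of the opinions along
      it.\<close>
    have "(\<lambda>t. \<Sum>i\<in>J k t. p t $ i * x t $ i) \<longlonglongrightarrow> 0" if k: "k \<le> c" for k
    proof (cases "k = 0 \<or> negligible_jet A (J k)")
      case True
      then have "(\<lambda>t. \<Sum>i\<in>J k t. p t $ i) \<longlonglongrightarrow> 0"
        using D p by (auto simp: negligible_jet_def sonin_decomposition_def)
      then show ?thesis by (rule jet_moment_tendsto_0[OF sp _ bd])
    next
      case False
      with k have k': "k \<in> {1..c}" "\<not> negligible_jet A (J k)" by auto
      note lims = sonin_jet_limit[OF A D k']
      obtain m where m: "(\<lambda>t. \<Sum>i\<in>J k t. p t $ i) \<longlonglongrightarrow> m"
        using sonin_mass_convergent[OF D k'(1) p] by blast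
      have "jet_limit (J k) x = 0" using v k' by (simp add: x_def[abs_def])
      then show ?thesis
        using jet_moment_tendsto[OF sp m lims(2,1) traj] by simp
    qed
    then have "(\<lambda>t. \<Sum>k\<le>c. \<Sum>i\<in>J k t. p t $ i * x t $ i) \<longlonglongrightarrow> (\<Sum>k\<le>c. 0)"
      by (intro tendsto_sum) simp
    moreover have "(\<Sum>k\<le>c. \<Sum>i\<in>J k t. p t $ i * x t $ i) = p t \<bullet> x t" for t
      by (simp add: inner_vec_def sum_jet_partition[OF part, of _ t])
    moreover have "(\<lambda>t. p t \<bullet> x t) \<longlonglongrightarrow> p \<tau> \<bullet> x \<tau>"
      by (rule tendsto_eventually, rule eventually_sequentiallyI[of \<tau>])
        (rule absolute_probability_inner_const[OF p traj])
    ultimately have "p \<tau> \<bullet> x \<tau> = 0" using LIMSEQ_unique by fastforce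
    then show ?thesis by (simp add: x_def state_transition_def)
  qed
  then show "v \<in> chain_null A \<tau>"
    by (simp add: chain_null_iff_absolute_probability[OF A])
qed

text \<open>After a late start at the indicator of one jet, hardly any mass flows between the jets, so
  the limit along a jet stays close to the initial value on it.\<close>

lemma sonin_jet_limit_indicator:
  fixes A :: "nat \<Rightarrow> real ^ 'n ^ 'n"
  assumes A: "\<And>t. row_stochastic (A t)" and D: "sonin_decomposition A c J"
    and j: "j \<in> {1..c}" "\<not> negligible_jet A (J j)" and \<delta>: "0 < \<delta>"
  shows "\<forall>\<^sub>F \<tau> in sequentially. \<forall>k\<in>{1..c}.
    \<bar>jet_limit (J j) (\<lambda>t. state_transition A t \<tau> *v (\<chi> i. if i \<in> J k \<tau> then 1 else 0))
      - (if j = k then 1 else 0)\<bar> \<le> \<delta>"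
proof -
  note lims = sonin_jet_limit[OF A D j]
  obtain p m where p: "absolute_probability A p" and m: "0 < m"
    and mass: "(\<lambda>t. \<Sum>i\<in>J j t. p t $ i) \<longlonglongrightarrow> m"
    using lims(3) by blast
  have sp: "stochastic_vector (p t)" for t using p by (simp add: absolute_probability_def)
  let ?f = "flow_rate A p (J j) (jet_compl (J j))"
  have f: "summable ?f" using sonin_flow_compl_summable[OF A D _ p] j by simp
  have disj: "J j t \<inter> J k t = {}" if "j \<noteq> k" "k \<in> {1..c}" for k t
    using D that j unfolding sonin_decomposition_def jet_partition_def disjoint_family_on_def
    by (meson atLeastAtMost_iff atMost_iff)
  \<comment> \<open>Two errors arise when the limit moment is compared with \<open>m\<close> times
    the ideal value: the mass exchanged after \<open>\<tau>\<close>, and the gap between the mass at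
    \<open>\<tau>\<close> and its limit \<open>m\<close>.\<close>
  have bound: "m * \<bar>jet_limit (J j) (\<lambda>t. state_transition A t \<tau> *v (\<chi> i. if i \<in> J k \<tau> then 1 else 0))
      - (if j = k then 1 else 0)\<bar> \<le> (\<Sum>n. ?f (n + \<tau>)) + \<bar>(\<Sum>i\<in>J j \<tau>. p \<tau> $ i) - m\<bar>"
    if k: "k \<in> {1..c}" for k \<tau>
  proof -
    define v :: "real ^ 'n" where "v = (\<chi> i. if i \<in> J k \<tau> then 1 else 0)"
    define x where "x t = state_transition A t \<tau> *v v" for t
    define d :: real where "d = (if j = k then 1 else 0)"
    have x_init: "x \<tau> = v" by (simp add: x_def state_transition_def)
    have traj: "opinion_trajectory A \<tau> x"
      unfolding x_def by (rule opinion_trajectory_state_transition)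
    \<comment> \<open>By disjointness the indicator of \<open>J k \<tau>\<close> is constant on
      \<open>J j \<tau>\<close>.\<close>
    have "(\<Sum>i\<in>J j \<tau>. p \<tau> $ i * x \<tau> $ i) = (\<Sum>i\<in>J j \<tau>. p \<tau> $ i * d)"
      using disj[of k \<tau>] k by (intro sum.cong) (auto simp: x_init v_def d_def)
    then have init: "(\<Sum>i\<in>J j \<tau>. p \<tau> $ i * x \<tau> $ i) = (\<Sum>i\<in>J j \<tau>. p \<tau> $ i) * d"
      by (simp add: sum_distrib_right)
    have "(\<lambda>t. \<bar>(\<Sum>i\<in>J j t. p t $ i * x t $ i) - (\<Sum>i\<in>J j \<tau>. p \<tau> $ i) * d\<bar>)
        \<longlonglongrightarrow> \<bar>m * jet_limit (J j) x - (\<Sum>i\<in>J j \<tau>. p \<tau> $ i) * d\<bar>"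
      by (intro tendsto_intros jet_moment_tendsto[OF sp mass lims(2,1) traj])
    moreover have "\<bar>(\<Sum>i\<in>J j t. p t $ i * x t $ i) - (\<Sum>i\<in>J j \<tau>. p \<tau> $ i) * d\<bar> \<le> (\<Sum>n. ?f (n + \<tau>))"
      if "\<tau> \<le> t" for t
      using jet_moment_variation_le[OF A p traj _ f that] unfolding init
      by (simp add: x_init v_def)
    ultimately have "\<bar>m * jet_limit (J j) x - (\<Sum>i\<in>J j \<tau>. p \<tau> $ i) * d\<bar> \<le> (\<Sum>n. ?f (n + \<tau>))"
      by (intro LIMSEQ_le_const2) auto
    moreover have "\<bar>((\<Sum>i\<in>J j \<tau>. p \<tau> $ i) - m) * d\<bar> \<le> \<bar>(\<Sum>i\<in>J j \<tau>. p \<tau> $ i) - m\<bar>"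
      by (simp add: d_def)
    moreover have "m * \<bar>jet_limit (J j) x - d\<bar> = \<bar>m * jet_limit (J j) x - m * d\<bar>"
      using m by (simp add: abs_mult flip: right_diff_distrib)
    ultimately show ?thesis
      unfolding x_def v_def d_def[symmetric] by (simp add: left_diff_distrib)
  qed
  \<comment> \<open>The bound does not involve \<open>k\<close>, so one threshold for
    \<open>\<tau>\<close> serves all \<open>k\<close>; dividing by \<open>m > 0\<close> then leaves
    \<open>\<delta>\<close>.\<close>
  have "(\<lambda>\<tau>. (\<Sum>n. ?f (n + \<tau>)) + \<bar>(\<Sum>i\<in>J j \<tau>. p \<tau> $ i) - m\<bar>) \<longlonglongrightarrow> 0 + \<bar>m - m\<bar>"
    by (intro tendsto_add tendsto_rabs tendsto_diff mass tendsto_const suminf_exist_split2 f)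
  then have "\<forall>\<^sub>F \<tau> in sequentially. (\<Sum>n. ?f (n + \<tau>)) + \<bar>(\<Sum>i\<in>J j \<tau>. p \<tau> $ i) - m\<bar> < m * \<delta>"
    using m \<delta> by (intro order_tendstoD) auto
  then show ?thesis
  proof eventually_elim
    case (elim \<tau>)
    show ?case
    proof
      fix k assume "k \<in> {1..c}"
      from bound[OF this, of \<tau>] elim m
      show "\<bar>jet_limit (J j) (\<lambda>t. state_transition A t \<tau> *v (\<chi> i. if i \<in> J k \<tau> then 1 else 0))
          - (if j = k then 1 else 0)\<bar> \<le> \<delta>"
        by (meson less_le_trans mult_le_cancel_left_pos not_less order_less_imp_le le_less_trans)
    qed
  qed
qed

lemma linear_jet_limit_state_transition:
  assumes conv: "consensus_jet A S"
    and ne: "\<forall>\<^sub>F t in sequentially. S t \<noteq> {}"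
  shows "linear (\<lambda>v. jet_limit S (\<lambda>t. state_transition A t \<tau> *v v))"
proof -
  let ?x = "\<lambda>v t. (state_transition A t \<tau> *v v) $ (SOME i. i \<in> S t)"
  let ?l = "\<lambda>v. jet_limit S (\<lambda>t. state_transition A t \<tau> *v v)"
  have lim: "?x v \<longlonglongrightarrow> ?l v" for v
    using ne by (intro jet_limit_selection[OF conv ne opinion_trajectory_state_transition])
      (auto simp: some_in_eq)
  show ?thesis
  proof (rule linearI)
    fix v w
    have "?x (v + w) \<longlonglongrightarrow> ?l v + ?l w"
      using tendsto_add[OF lim[of v] lim[of w]] by (simp add: matrix_vector_right_distrib)
    then show "?l (v + w) = ?l v + ?l w" using lim LIMSEQ_unique by blast
  next
    fix r v
    have "?x (r *\<^sub>R v) \<longlonglongrightarrow> r * ?l v"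
      using tendsto_mult_left[OF lim[of v], of r]
      by (simp add: matrix_vector_mult_scaleR)
    from LIMSEQ_unique[OF lim this] show "?l (r *\<^sub>R v) = r *\<^sub>R ?l v" by simp
  qed
qed

text \<open>The decomposition is unique only up to negligible jets, so the count is over the indices
  \<open>k \<ge> 1\<close> with a non-negligible jet. It equals \<open>c\<close> once none of
  \<open>J 1\<close>, ..., \<open>J c\<close> is negligible.\<close>

theorem theorem8:
  fixes A :: "nat \<Rightarrow> real ^ 'n ^ 'n" and c :: nat and J :: "nat \<Rightarrow> 'n jet"
  assumes "\<And>t. row_stochastic (A t)"
    and "sonin_decomposition A c J"
  shows "card {k \<in> {1..c}. \<not> negligible_jet A (J k)} = chain_rank A \<and>
         ((\<forall>k\<in>{1..c}. \<not> negligible_jet A (J k)) \<longrightarrow> c = chain_rank A)"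
proof -
  note A = assms(1) and D = assms(2)
  define K where "K = {k \<in> {1..c}. \<not> negligible_jet A (J k)}"
  define L where "L \<tau> k v = jet_limit (J k) (\<lambda>t. state_transition A t \<tau> *v v)" for \<tau> k v
  \<comment> \<open>The summand 1 avoids a zero denominator and makes
    \<open>card K * \<delta> < 1\<close> strict.\<close>
  define \<delta> where "\<delta> = 1 / (real (card K) + 1)"
  have \<delta>: "0 < \<delta>" "real (card K) * \<delta> < 1" by (auto simp: \<delta>_def field_simps)
  have finK: "finite K" by (simp add: K_def)
  have null: "chain_null A \<tau> = {v. \<forall>k\<in>K. L \<tau> k v = 0}" for \<tau>
    unfolding K_def L_def by (rule sonin_chain_null[OF A D])
  have lin: "linear (L \<tau> k)" if "k \<in> K" for \<tau> k
    using that unfolding L_def K_def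
    by (intro linear_jet_limit_state_transition sonin_jet_limit(1,2)[OF A D]) auto
  have "\<forall>\<^sub>F \<tau> in sequentially. \<forall>j\<in>K. \<forall>k\<in>{1..c}.
      \<bar>L \<tau> j (\<chi> i. if i \<in> J k \<tau> then 1 else 0) - (if j = k then 1 else 0)\<bar> \<le> \<delta>"
    unfolding L_def using finK \<delta>(1)
    by (intro eventually_ball_finite ballI sonin_jet_limit_indicator[OF A D]) (auto simp: K_def)
  then have ev: "\<forall>\<^sub>F \<tau> in sequentially. dim (chain_null A \<tau>) + card K = CARD('n)"
  proof eventually_elim
    case (elim \<tau>)
    show ?case
      unfolding null
      using dim_common_kernel_near_dual[of K "L \<tau>" "\<lambda>k. \<chi> i. if i \<in> J k \<tau> then 1 else 0" \<delta>]
        elim finK lin \<delta>(2) by (simp add: K_def)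
  qed
  then have "\<forall>\<^sub>F \<tau> in sequentially. dim (chain_null A \<tau>) = CARD('n) - card K"
    by eventually_elim simp
  then have "chain_nullity A = CARD('n) - card K"
    unfolding chain_nullity_def by (intro limI tendsto_eventually)
  \<comment> \<open>This undoes the nested truncated subtractions in
    \<open>chain_rank\<close>.\<close>
  moreover have "card K \<le> CARD('n)"
    using eventually_happens'[OF _ ev] by fastforce
  ultimately have "card K = chain_rank A" by (simp add: chain_rank_def)
  moreover have "c = card K" if "\<forall>k\<in>{1..c}. \<not> negligible_jet A (J k)"
  proof -
    have "K = {1..c}" using that by (auto simp: K_def)
    then show ?thesis by simp
  qed
  ultimately show ?thesis by (simp add: K_def)
qed

end
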